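(* Every Ptolemy metric space $(X,d)$ admits an isometric embedding into a Ptolemy metric space $(Y,d_Y)$ with the property that any three points of $Y$ lie on a circle in $Y$.
   Context: A metric space $(X,d)$ is Ptolemy if $d(x,y)d(z,w)\le d(x,z)d(y,w)+d(x,w)d(y,z)$ for all $x,y,z,w\in X$. A circle in a Ptolemy metric space $Y$ is a subset $\sigma$ homeomorphic to $S^1$ such that for all distinct $x,y,z,w\in\sigma$ with $y,w$ in different components of $\sigma\setminus\{x,z\}$, $d_Y(x,z)d_Y(y,w)=d_Y(x,y)d_Y(z,w)+d_Y(x,w)d_Y(y,z)$. *)

theory Defs
  imports "HOL-Analysis.Analysis"
begin

definition Ptolemy_metric :: "'a set \<Rightarrow> ('a \<Rightarrow> 'a \<Rightarrow> real) \<Rightarrow> bool" where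
  "Ptolemy_metric M d \<longleftrightarrow> Metric_space M d \<and>
     (\<forall>x\<in>M. \<forall>y\<in>M. \<forall>z\<in>M. \<forall>w\<in>M. d x y * d z w \<le> d x z * d y w + d x w * d y z)"

definition is_circle :: "'a set \<Rightarrow> ('a \<Rightarrow> 'a \<Rightarrow> real) \<Rightarrow> 'a set \<Rightarrow> bool" where
  "is_circle M d \<sigma> \<longleftrightarrow> \<sigma> \<subseteq> M \<and>
     (subtopology (Metric_space.mtopology M d) \<sigma>)
        homeomorphic_space (top_of_set (sphere (0::complex) 1)) \<and>
     (\<forall>x\<in>\<sigma>. \<forall>y\<in>\<sigma>. \<forall>z\<in>\<sigma>. \<forall>w\<in>\<sigma>.
        distinct [x, y, z, w] \<and>
        \<not> connected_component_of (subtopology (Metric_space.mtopology M d) (\<sigma> - {x, z})) y w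
        \<longrightarrow> d x z * d y w = d x y * d z w + d x w * d y z)"

end

(*
A pair of points x, y of a Ptolemy space M can be joined by a segment of new points m_s, 0 < s < 1,
with d(m_s, p) = (1-s) d(x,p) + s d(y,p) for all p in M and d(m_s, m_r) = |s-r| d(x,y); several
segments are attached at once by extending d bilinearly. The Ptolemy inequality survives: it is
linear in each of its four points, and for two points on a common segment it becomes a bound on
a 2x2 determinant of distances, which is the Ptolemy inequality with x, y in place of these points.
For three points of M, the three segments attached to them form a circle: the distances are the
absolute determinants of vectors in the plane, so Ptolemy's equality is the Pluecker relation.
Attaching segments to all pairs of points countably often gives Y.
*)
theory Submission
  imports Defs
begin

section \<open>Attaching segments to a Ptolemy space\<close>

definition seg_bilin ::
    "('b \<Rightarrow> 'b \<Rightarrow> real) \<Rightarrow> ('b \<Rightarrow> 'b) \<Rightarrow> ('b \<Rightarrow> 'b) \<Rightarrow> ('b \<Rightarrow> real) \<Rightarrow> 'b \<Rightarrow> 'b \<Rightarrow> real" where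
  "seg_bilin d a b t p q =
     (1 - t p) * ((1 - t q) * d (a p) (a q) + t q * d (a p) (b q)) +
     t p * ((1 - t q) * d (b p) (a q) + t q * d (b p) (b q))"

text \<open>On a single segment \<open>seg_bilin\<close> is too large: at \<open>p = q\<close> with
  parameter \<open>s\<close> it gives \<open>2 s (1 - s)\<close> times the length of the segment
  instead of 0. There the distance along the segment replaces it.\<close>

definition seg_dist ::
    "('b \<Rightarrow> 'b \<Rightarrow> real) \<Rightarrow> ('b \<Rightarrow> 'b) \<Rightarrow> ('b \<Rightarrow> 'b) \<Rightarrow> ('b \<Rightarrow> real) \<Rightarrow> 'b \<Rightarrow> 'b \<Rightarrow> real" where
  "seg_dist d a b t p q =
     (if a p = a q \<and> b p = b q then \<bar>t p - t q\<bar> * d (a p) (b p) else seg_bilin d a b t p q)"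

definition ptolemy_quad :: "('b \<Rightarrow> 'b \<Rightarrow> real) \<Rightarrow> 'b \<Rightarrow> 'b \<Rightarrow> 'b \<Rightarrow> 'b \<Rightarrow> bool" where
  "ptolemy_quad e p q r s \<longleftrightarrow> e p q * e r s \<le> e p r * e q s + e p s * e q r"

text \<open>The swaps keep \<open>p, q\<close> paired against \<open>r, s\<close> and at most
  exchange the summands on the right. They bring every case below into one arrangement.\<close>

lemma ptolemy_quad_swap:
  assumes "\<And>x y. e x y = e y x"
  shows "ptolemy_quad e p q r s \<Longrightarrow> ptolemy_quad e q p r s"
    and "ptolemy_quad e p q r s \<Longrightarrow> ptolemy_quad e p q s r"
    and "ptolemy_quad e p q r s \<Longrightarrow> ptolemy_quad e r s p q"
  using assms unfolding ptolemy_quad_def by (auto simp: mult.commute add.commute)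

lemma convex_comb_le:
  fixes t :: real
  assumes "u \<le> v" "u' \<le> v'" "0 \<le> t" "t \<le> 1"
  shows "(1 - t) * u + t * u' \<le> (1 - t) * v + t * v'"
  using assms by (intro add_mono mult_left_mono) auto

lemma ptolemy_real:
  fixes s1 :: real
  shows "\<bar>s1 - s2\<bar> * \<bar>s3 - s4\<bar> \<le> \<bar>s1 - s3\<bar> * \<bar>s2 - s4\<bar> + \<bar>s1 - s4\<bar> * \<bar>s2 - s3\<bar>"
proof -
  have "(s1 - s2) * (s3 - s4) = (s1 - s3) * (s2 - s4) - (s1 - s4) * (s2 - s3)"
    by (simp add: algebra_simps)
  then show ?thesis
    by (metis abs_mult abs_triangle_ineq4)
qed

text \<open>This is the case of three points on one segment and a fourth point whose distance
  \<open>f\<close> is affine along it, with the length of the segment cancelled.\<close>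

lemma affine_ptolemy:
  fixes s1 :: real
  assumes f: "\<And>s. f s = (1 - s) * u + s * v" and "f s1 \<ge> 0" "f s2 \<ge> 0" "f s3 \<ge> 0"
  shows "\<bar>s1 - s2\<bar> * f s3 \<le> \<bar>s1 - s3\<bar> * f s2 + \<bar>s2 - s3\<bar> * f s1"
proof -
  have "(s1 - s2) * f s3 = (s1 - s3) * f s2 - (s2 - s3) * f s1"
    unfolding f by (simp add: algebra_simps)
  then have "\<bar>s1 - s2\<bar> * f s3 = \<bar>(s1 - s3) * f s2 - (s2 - s3) * f s1\<bar>"
    using assms by (metis abs_mult abs_of_nonneg)
  also have "\<dots> \<le> \<bar>s1 - s3\<bar> * f s2 + \<bar>s2 - s3\<bar> * f s1"
    using assms by (metis abs_mult abs_of_nonneg abs_triangle_ineq4)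
  finally show ?thesis .
qed

text \<open>A point \<open>p\<close> of \<open>N - M\<close> is the one at parameter \<open>t p\<close> on the segment from \<open>a p\<close> to \<open>b p\<close>;
  points of \<open>M\<close> count as degenerate segments.\<close>

locale segment_extension =
  fixes M N :: "'b set" and d :: "'b \<Rightarrow> 'b \<Rightarrow> real" and a b :: "'b \<Rightarrow> 'b" and t :: "'b \<Rightarrow> real"
  assumes ptolemy: "Ptolemy_metric M d"
    and sub: "M \<subseteq> N"
    and ends: "p \<in> N \<Longrightarrow> a p \<in> M" "p \<in> N \<Longrightarrow> b p \<in> M"
    and old: "p \<in> M \<Longrightarrow> a p = p" "p \<in> M \<Longrightarrow> b p = p" "p \<in> M \<Longrightarrow> t p = 0"
    and t_range: "0 \<le> t p" "t p \<le> 1"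
    and new: "p \<in> N - M \<Longrightarrow> a p \<noteq> b p" "p \<in> N - M \<Longrightarrow> 0 < t p" "p \<in> N - M \<Longrightarrow> t p < 1"
    and inj: "\<lbrakk>p \<in> N - M; q \<in> N - M; a p = a q; b p = b q; t p = t q\<rbrakk> \<Longrightarrow> p = q"
begin

sublocale Metric_space M d
  using ptolemy unfolding Ptolemy_metric_def by blast

abbreviation "E \<equiv> seg_bilin d a b t"
abbreviation "D \<equiv> seg_dist d a b t"
text \<open>The ends are compared in order, so the segments from \<open>x\<close> to
  \<open>y\<close> and from \<open>y\<close> to \<open>x\<close> stay different. Within
  \<open>N\<close>, an old point is \<open>sim\<close> only to itself.\<close>

abbreviation sim where "sim p q \<equiv> a p = a q \<and> b p = b q"

lemma ptol: "\<lbrakk>p \<in> M; q \<in> M; r \<in> M; s \<in> M\<rbrakk> \<Longrightarrow> ptolemy_quad d p q r s"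
  using ptolemy unfolding Ptolemy_metric_def ptolemy_quad_def by blast

section \<open>The bilinear form: Ptolemy and triangle inequalities\<close>

lemma E_sym: "E p q = E q p"
  by (simp add: seg_bilin_def commute algebra_simps)

lemma D_sym: "D p q = D q p"
  by (simp add: seg_dist_def E_sym abs_minus_commute)

lemma E_old: "\<lbrakk>p \<in> M; q \<in> M\<rbrakk> \<Longrightarrow> E p q = d p q"
  by (simp add: seg_bilin_def old)

text \<open>The ends are old, hence degenerate segments, so \<open>E\<close> evaluates them without
  a further convex combination.\<close>

lemma E_left: "p \<in> N \<Longrightarrow> E p q = (1 - t p) * E (a p) q + t p * E (b p) q"
  by (simp add: seg_bilin_def old ends algebra_simps)

lemma E_nonneg: "0 \<le> E p q"
  unfolding seg_bilin_def by (intro add_nonneg_nonneg mult_nonneg_nonneg) (simp_all add: t_range)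

text \<open>Each of the three products contains \<open>p\<close> exactly once, so both sides are
  affine in \<open>p\<close> and it suffices to check the two ends.\<close>

lemma E_quad_left:
  assumes "p \<in> N" "ptolemy_quad E (a p) q r s" "ptolemy_quad E (b p) q r s"
  shows "ptolemy_quad E p q r s"
  using convex_comb_le[OF assms(2,3)[unfolded ptolemy_quad_def] t_range[of p]]
  unfolding ptolemy_quad_def E_left[OF assms(1), of q] E_left[OF assms(1), of r] E_left[OF assms(1), of s]
  by (simp add: algebra_simps)

text \<open>The points are released from \<open>M\<close> one at a time: \<open>E_quad_left\<close>
  frees the first position, and the swaps move the points into place.\<close>

lemma E_quad:
  assumes "p \<in> N" "q \<in> N" "r \<in> N" "s \<in> N"
  shows "ptolemy_quad E p q r s"
proof -
  note swap = ptolemy_quad_swap[where e = E, OF E_sym]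
  have 0: "ptolemy_quad E p q r s" if "p \<in> M" "q \<in> M" "r \<in> M" "s \<in> M" for p q r s
    using ptol[OF that] that unfolding ptolemy_quad_def by (simp add: E_old)
  have 1: "ptolemy_quad E p q r s" if "p \<in> N" "q \<in> M" "r \<in> M" "s \<in> M" for p q r s
    by (rule E_quad_left) (use that ends in \<open>auto intro: 0\<close>)
  have 2: "ptolemy_quad E p q r s" if "p \<in> N" "q \<in> N" "r \<in> M" "s \<in> M" for p q r s
    by (rule E_quad_left) (use that ends in \<open>auto intro!: swap(1)[OF 1]\<close>)
  have 4: "ptolemy_quad E p q r s" if "p \<in> N" "q \<in> M" "r \<in> N" "s \<in> M" for p q r s
    by (rule E_quad_left) (use that ends in \<open>auto intro!: swap(3)[OF 1]\<close>)
  have 3: "ptolemy_quad E p q r s" if "p \<in> N" "q \<in> N" "r \<in> N" "s \<in> M" for p q r s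
    by (rule E_quad_left) (use that ends in \<open>auto intro!: swap(1)[OF 4]\<close>)
  show ?thesis
    by (rule E_quad_left) (use assms ends in \<open>auto intro!: swap(1)[OF swap(3)[OF 3]] swap(3)[OF swap(2)[OF 3]]\<close>)
qed

lemma E_triangle_left:
  assumes "p \<in> N" "E (a p) r \<le> E (a p) q + E q r" "E (b p) r \<le> E (b p) q + E q r"
  shows "E p r \<le> E p q + E q r"
  using convex_comb_le[OF assms(2,3) t_range[of p]]
  unfolding E_left[OF assms(1), of q] E_left[OF assms(1), of r]
  by (simp add: algebra_simps)

lemma E_triangle_mid:
  assumes "q \<in> N" "E p r \<le> E p (a q) + E (a q) r" "E p r \<le> E p (b q) + E (b q) r"
  shows "E p r \<le> E p q + E q r"
  using convex_comb_le[OF assms(2,3) t_range[of q]]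
  unfolding E_left[OF assms(1), of r] E_sym[of p] E_left[OF assms(1), of p]
  by (simp add: algebra_simps)

text \<open>Both sides are affine in each of the three points, a side without the point being
  constant, so everything reduces to points of \<open>M\<close>.\<close>

lemma E_triangle:
  assumes "p \<in> N" "q \<in> N" "r \<in> N"
  shows "E p r \<le> E p q + E q r"
proof -
  have 0: "E p r \<le> E p q + E q r" if "p \<in> M" "q \<in> M" "r \<in> M" for p q r
    using that triangle by (simp add: E_old)
  have 1: "E p r \<le> E p q + E q r" if "p \<in> N" "q \<in> M" "r \<in> M" for p q r
    by (rule E_triangle_left) (use that ends in \<open>auto intro: 0\<close>)
  have 5: "E p r \<le> E p q + E q r" if "p \<in> M" "q \<in> M" "r \<in> N" for p q r
    using 1[OF that(3,2,1)] by (simp add: E_sym)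
  have 2: "E p r \<le> E p q + E q r" if "p \<in> N" "q \<in> M" "r \<in> N" for p q r
    by (rule E_triangle_left) (use that ends in \<open>auto intro: 5\<close>)
  show ?thesis
    by (rule E_triangle_mid) (use assms ends in \<open>auto intro: 2\<close>)
qed

section \<open>The corrected distance is a Ptolemy metric\<close>

lemma D_not_sim: "\<not> sim p q \<Longrightarrow> D p q = E p q"
  by (auto simp: seg_dist_def)

lemma D_sim: "sim p q \<Longrightarrow> D p q = \<bar>t p - t q\<bar> * d (a p) (b p)"
  by (auto simp: seg_dist_def)

lemma D_nonneg: "0 \<le> D p q"
  by (simp add: seg_dist_def E_nonneg)

text \<open>On a common segment this is
  \<open>\<bar>s - r\<bar> = \<bar>s (1 - r) - r (1 - s)\<bar>\<close> and the triangle inequality.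
  Hence passing from \<open>E\<close> to \<open>D\<close> is harmless on the smaller side of an
  inequality.\<close>

lemma D_le_E:
  assumes "p \<in> N" "q \<in> N"
  shows "D p q \<le> E p q"
proof (cases "sim p q")
  case True
  then have "E p q = ((1 - t p) * t q + t p * (1 - t q)) * d (a p) (b p)"
    using assms ends by (simp add: seg_bilin_def commute algebra_simps)
  moreover have "\<bar>t p - t q\<bar> \<le> (1 - t p) * t q + t p * (1 - t q)"
    using mult_nonneg_nonneg[of "1 - t p" "t q"] mult_nonneg_nonneg[of "t p" "1 - t q"] t_range assms
    by (auto simp: abs_if algebra_simps)
  ultimately show ?thesis
    using True by (simp add: D_sim mult_right_mono)
qed (simp add: D_not_sim)

text \<open>The rows \<open>p\<close>, \<open>p'\<close> arise from the rows \<open>a p\<close>,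
  \<open>b p\<close> by the matrix with rows \<open>(1 - t p, t p)\<close> and
  \<open>(1 - t p', t p')\<close>, whose determinant is \<open>t p' - t p\<close>.\<close>

lemma E_det_sim:
  assumes "p \<in> N" "p' \<in> N" "sim p p'"
  shows "E p q * E p' r - E p r * E p' q =
    (t p' - t p) * (E (a p) q * E (b p) r - E (a p) r * E (b p) q)"
proof -
  have "E p q = (1 - t p) * E (a p) q + t p * E (b p) q"
    "E p r = (1 - t p) * E (a p) r + t p * E (b p) r"
    "E p' q = (1 - t p') * E (a p) q + t p' * E (b p) q"
    "E p' r = (1 - t p') * E (a p) r + t p' * E (b p) r"
    using assms E_left by auto
  then show ?thesis
    by (simp only:) (simp add: algebra_simps)
qed

text \<open>Two instances of the Ptolemy inequality together bound the determinant with rows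
  \<open>p\<close>, \<open>r\<close> and columns \<open>q\<close>, \<open>s\<close> from both
  sides.\<close>

lemma E_quad_abs:
  assumes "p \<in> N" "q \<in> N" "r \<in> N" "s \<in> N"
  shows "\<bar>E p q * E r s - E p s * E r q\<bar> \<le> E p r * E q s"
  using E_quad[of p q r s] E_quad[of p s r q] assms E_sym[of q r] E_sym[of q s] E_sym[of r s]
  unfolding ptolemy_quad_def by (auto simp: abs_le_iff algebra_simps)

text \<open>If \<open>q\<close> and \<open>r\<close> share a segment, \<open>E_det_sim\<close> for
  the columns extracts the factor \<open>t r - t q\<close> and leaves a determinant of old points,
  to which \<open>E_quad_abs\<close> applies.\<close>

lemma E_quad_abs_D:
  assumes "x \<in> M" "y \<in> M" "q \<in> N" "r \<in> N"
  shows "\<bar>E x q * E y r - E x r * E y q\<bar> \<le> d x y * D q r"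
proof (cases "sim q r")
  case False
  then show ?thesis
    using E_quad_abs[of x q y r] assms sub by (auto simp: D_not_sim E_old)
next
  case True
  let ?x = "a q" and ?y = "b q"
  have "E x q * E y r - E x r * E y q =
      (t r - t q) * (E ?x x * E ?y y - E ?x y * E ?y x)"
    using E_det_sim[OF assms(3,4) True, of x y] by (simp add: E_sym algebra_simps)
  moreover have "\<bar>E ?x x * E ?y y - E ?x y * E ?y x\<bar> \<le> d ?x ?y * d x y"
    using E_quad_abs[of ?x x ?y y] assms sub ends by (auto simp: E_old subset_iff)
  ultimately have "\<bar>E x q * E y r - E x r * E y q\<bar> \<le> \<bar>t r - t q\<bar> * (d ?x ?y * d x y)"
    by (simp add: abs_mult mult_left_mono)
  then show ?thesis
    by (simp only: D_sim[OF True]) (simp add: abs_minus_commute mult_ac)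
qed

text \<open>\<open>E_det_sim\<close> moves the rows to the old points \<open>a p\<close>,
  \<open>b p\<close>; \<open>E_quad_abs_D\<close> then treats the columns, which may share a segment
  of their own.\<close>

lemma D_det_sim:
  assumes "p \<in> N" "p' \<in> N" "sim p p'" "q \<in> N" "r \<in> N"
  shows "\<bar>E p q * E p' r - E p r * E p' q\<bar> \<le> D p p' * D q r"
  using mult_left_mono[OF E_quad_abs_D[of "a p" "b p" q r], of "\<bar>t p' - t p\<bar>"]
    assms ends E_det_sim[OF assms(1-3), of q r]
  by (simp add: D_sim abs_mult abs_minus_commute mult.assoc)

lemma D_quad_three:
  assumes "p \<in> N" "q \<in> N" "r \<in> N" "s \<in> N" "sim p q" "sim p r" "\<not> sim p s"
  shows "ptolemy_quad D p q r s"
proof -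
  define f where "f = (\<lambda>u. (1 - u) * E (a p) s + u * E (b p) s)"
  have f: "D p s = f (t p)" "D q s = f (t q)" "D r s = f (t r)"
    using E_left[of p s] E_left[of q s] E_left[of r s] assms by (auto simp: D_not_sim f_def)
  have "0 \<le> f (t p)" "0 \<le> f (t q)" "0 \<le> f (t r)"
    unfolding f[symmetric] by (rule D_nonneg)+
  then have "\<bar>t p - t q\<bar> * f (t r) \<le> \<bar>t p - t r\<bar> * f (t q) + \<bar>t q - t r\<bar> * f (t p)"
    by (intro affine_ptolemy[where u = "E (a p) s" and v = "E (b p) s"]) (simp_all only: f_def)
  from mult_right_mono[OF this, of "d (a p) (b p)"] show ?thesis
    using assms unfolding ptolemy_quad_def f by (auto simp: D_sim algebra_simps)
qed

lemma D_quad_four: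
  assumes "sim p q" "sim p r" "sim p s"
  shows "ptolemy_quad D p q r s"
proof -
  have "sim q r" "sim q s" "sim r s" using assms by auto
  then show ?thesis
    using mult_right_mono[OF ptolemy_real[of "t p" "t q" "t r" "t s"], of "d (a p) (b p) * d (a p) (b p)"] assms
    unfolding ptolemy_quad_def by (simp add: D_sim algebra_simps)
qed

text \<open>Only the pairs on the left may share a segment, so \<open>D\<close> and \<open>E\<close>
  agree on the right and the left only shrinks.\<close>

lemma D_quad_first:
  assumes "p \<in> N" "q \<in> N" "r \<in> N" "s \<in> N" "\<not> sim p r" "\<not> sim p s" "\<not> sim q r" "\<not> sim q s"
  shows "ptolemy_quad D p q r s"
proof -
  have "D p q * D r s \<le> E p q * E r s"
    using assms by (intro mult_mono D_le_E E_nonneg D_nonneg)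
  then show ?thesis
    using E_quad[of p q r s] assms by (auto simp: ptolemy_quad_def D_not_sim)
qed

text \<open>The shared segment now appears on the right, where \<open>D_le_E\<close> points the
  wrong way; the determinant bound takes its place.\<close>

lemma D_quad_second:
  assumes "p \<in> N" "q \<in> N" "r \<in> N" "s \<in> N" "sim p r" "\<not> sim p q" "\<not> sim p s"
  shows "ptolemy_quad D p q r s"
proof -
  have "D p q = E p q" "D r s = E r s" "D p s = E p s" "D q r = E r q"
    using assms by (auto simp: D_not_sim E_sym)
  then show ?thesis
    using D_det_sim[of p r q s] assms by (auto simp: ptolemy_quad_def)
qed

lemma D_quad:
  assumes "p \<in> N" "q \<in> N" "r \<in> N" "s \<in> N"
  shows "ptolemy_quad D p q r s"
proof -
  note swap = ptolemy_quad_swap[where e = D, OF D_sym]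
  \<comment> \<open>By the swaps, \<open>p, r\<close> represents each of the four pairs that occur
    on the right-hand side.\<close>
  have pr: "ptolemy_quad D p q r s"
    if "p \<in> N" "q \<in> N" "r \<in> N" "s \<in> N" "sim p r" for p q r s
  proof -
    consider "sim p q" "sim p s" | "sim p q" "\<not> sim p s" | "\<not> sim p q" "sim p s" | "\<not> sim p q" "\<not> sim p s"
      by blast
    then show ?thesis
    proof cases
      case 1 then show ?thesis using that by (intro D_quad_four)
    next
      case 2 then show ?thesis using that by (intro D_quad_three)
    next
      case 3
      then have "ptolemy_quad D r s p q" using that by (intro D_quad_three) auto
      then show ?thesis by (rule swap(3))
    next
      case 4 then show ?thesis using that by (intro D_quad_second)
    qed
  qed
  consider "sim p r" | "sim p s" | "sim q r" | "sim q s"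
    | "\<not> sim p r" "\<not> sim p s" "\<not> sim q r" "\<not> sim q s" by blast
  then show ?thesis
  proof cases
    case 1 then show ?thesis using assms by (intro pr)
  next
    case 2 then show ?thesis using assms by (intro swap(2)[OF pr])
  next
    case 3 then show ?thesis using assms by (intro swap(1)[OF pr])
  next
    case 4 then show ?thesis using assms by (intro swap(1)[OF swap(2)[OF pr]])
  next
    case 5 then show ?thesis using assms by (intro D_quad_first)
  qed
qed

text \<open>Along a segment \<open>E\<close> is affine in the parameter, with slope at most the
  length of the segment by \<open>E_triangle\<close>. This serves the triangle inequality when just
  two consecutive points share a segment.\<close>

lemma D_sim_diff:
  assumes "p \<in> N" "q \<in> N" "r \<in> N" "sim p q"
  shows "\<bar>E p r - E q r\<bar> \<le> D p q"
proof -
  have "E p r - E q r = (t q - t p) * (E (a p) r - E (b p) r)"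
    using E_left[of p r] E_left[of q r] assms by (simp add: algebra_simps)
  moreover have "\<bar>E (a p) r - E (b p) r\<bar> \<le> d (a p) (b p)"
    using E_triangle[of "a p" "b p" r] E_triangle[of "b p" "a p" r] assms ends[OF assms(1)] sub E_old commute
    by (auto simp: abs_le_iff subset_iff algebra_simps)
  ultimately show ?thesis
    using assms by (simp add: D_sim abs_mult abs_minus_commute mult_left_mono)
qed

lemma D_triangle:
  assumes "p \<in> N" "q \<in> N" "r \<in> N"
  shows "D p r \<le> D p q + D q r"
proof -
  consider "sim p q" "sim q r" | "sim p q" "\<not> sim q r" | "\<not> sim p q" "sim q r" | "\<not> sim p q" "\<not> sim q r"
    by blast
  then show ?thesis
  proof cases
    case 1
    then show ?thesis
      using mult_right_mono[of "\<bar>t p - t r\<bar>" "\<bar>t p - t q\<bar> + \<bar>t q - t r\<bar>" "d (a p) (b p)"]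
      by (simp add: D_sim algebra_simps)
  next
    case 2
    then show ?thesis
      using D_sim_diff[of p q r] D_not_sim[of p r] D_not_sim[of q r] assms by auto
  next
    case 3
    then show ?thesis
      using D_sim_diff[of q r p] D_not_sim[of p r] D_not_sim[of p q] E_sym[of p] assms by auto
  next
    case 4
    then show ?thesis
      using D_le_E[of p r] E_triangle[of p q r] D_not_sim[of p q] D_not_sim[of q r] assms by linarith
  qed
qed

lemma D_old: "\<lbrakk>p \<in> M; q \<in> M\<rbrakk> \<Longrightarrow> D p q = d p q"
  by (auto simp: seg_dist_def E_old old)

lemma D_eq_0:
  assumes "p \<in> N" "q \<in> N" "D p q = 0"
  shows "p = q"
proof (cases "sim p q")
  case True
  show ?thesis
  proof (cases "a p = b p")
    case True
    then have "p \<in> M" "q \<in> M" using assms \<open>sim p q\<close> new by (metis DiffI)+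
    then show ?thesis using \<open>sim p q\<close> old by metis
  next
    case False
    then have "p \<in> N - M" "q \<in> N - M" using True assms old by auto
    moreover have "t p = t q" using True False assms ends by (auto simp: D_sim)
    ultimately show ?thesis using True inj by blast
  qed
next
  case False
  have "E p q = 0" using assms False by (simp add: D_not_sim)
  \<comment> \<open>All four summands are nonnegative, so each vanishes. A new point has two
    positive weights, so both ends of its segment would be at distance 0 from one old point and
    coincide.\<close>
  then have "(1 - t p) * (1 - t q) * d (a p) (a q) + (1 - t p) * t q * d (a p) (b q) +
      (t p * (1 - t q) * d (b p) (a q) + t p * t q * d (b p) (b q)) = 0"
    by (simp add: seg_bilin_def algebra_simps)
  then have z: "(1 - t p) * (1 - t q) * d (a p) (a q) = 0" "(1 - t p) * t q * d (a p) (b q) = 0"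
    "t p * (1 - t q) * d (b p) (a q) = 0" "t p * t q * d (b p) (b q) = 0"
    using t_range by (simp_all add: add_nonneg_eq_0_iff)
  show ?thesis
  proof (cases "p \<in> M"; cases "q \<in> M")
    assume "p \<in> M" "q \<in> M"
    then show ?thesis using assms by (simp add: D_old)
  next
    assume "p \<in> M" "q \<notin> M"
    then show ?thesis using z new[of q] assms ends by (auto simp: old)
  next
    assume "p \<notin> M" "q \<in> M"
    then show ?thesis using z new[of p] assms ends by (auto simp: old)
  next
    assume "p \<notin> M" "q \<notin> M"
    then show ?thesis using z new[of q] new[of p] assms ends by auto
  qed
qed

lemma Ptolemy_metric_D: "Ptolemy_metric N D"
  unfolding Ptolemy_metric_def
proof (intro conjI ballI)
  have "D p p = 0" for p by (simp add: D_sim)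
  then show "Metric_space N D"
    by unfold_locales (auto simp: D_sym D_nonneg D_eq_0 intro: D_triangle)
  show "D x y * D z w \<le> D x z * D y w + D x w * D y z" if "x \<in> N" "y \<in> N" "z \<in> N" "w \<in> N" for x y z w
    using D_quad[OF that] by (simp add: ptolemy_quad_def)
qed
end

section \<open>Circles from determinants\<close>

text \<open>For increasing parameters the determinants carry no absolute value, so Ptolemy's
  equality is a polynomial identity. It remains to see that the curve is a topological circle and
  that separated pairs have interlacing parameters.\<close>

lemma Ptolemy_circle_from_determinant:
  fixes P Q :: "real \<Rightarrow> real" and \<gamma> :: "real \<Rightarrow> 'b"
  assumes met: "Metric_space M d"
    and L: "0 < L"
    and in_M: "\<And>s. s \<in> {0..L} \<Longrightarrow> \<gamma> s \<in> M"
    and closed: "\<gamma> L = \<gamma> 0"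
    and inj: "inj_on \<gamma> {0..<L}"
    and cont: "continuous_on {0..L} P" "continuous_on {0..L} Q"
    and det: "\<And>s t. \<lbrakk>0 \<le> s; s \<le> t; t \<le> L\<rbrakk> \<Longrightarrow> d (\<gamma> s) (\<gamma> t) = P s * Q t - P t * Q s"
  shows "is_circle M d (\<gamma> ` {0..L})"
proof -
  interpret Metric_space M d by (rule met)
  let ?I = "top_of_set {0..L}" and ?S = "top_of_set (sphere (0::complex) 1)"
  let ?C = "\<gamma> ` {0..L}"
  have det_abs: "d (\<gamma> s) (\<gamma> t) = \<bar>P s * Q t - P t * Q s\<bar>" if "s \<in> {0..L}" "t \<in> {0..L}" for s t
  proof (cases "s \<le> t")
    case True
    then show ?thesis using det[of s t] that by (metis abs_of_nonneg atLeastAtMost_iff nonneg)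
  next
    case False
    then have "d (\<gamma> s) (\<gamma> t) = P t * Q s - P s * Q t"
      using det[of t s] commute[of "\<gamma> s"] that by auto
    then show ?thesis by (metis abs_minus_commute abs_of_nonneg nonneg)
  qed
  have C_eq: "?C = \<gamma> ` {0..<L}"
  proof -
    have "{0..L} = insert L {0..<L}" "\<gamma> L \<in> \<gamma> ` {0..<L}" using L closed by auto
    then show ?thesis by (metis image_insert insert_absorb)
  qed
  have \<gamma>_cont: "continuous_map ?I mtopology \<gamma>"
    unfolding continuous_map_to_metric
  proof (intro ballI allI impI)
    fix s and \<epsilon> :: real assume s: "s \<in> topspace ?I" and "\<epsilon> > 0"
    \<comment> \<open>The distance from \<open>\<gamma> s\<close> is continuous in \<open>t\<close>
      and vanishes at \<open>t = s\<close>.\<close>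
    have "continuous_on {0..L} (\<lambda>t. \<bar>P s * Q t - P t * Q s\<bar>)"
      by (intro continuous_intros cont)
    then have "openin ?I ({0..L} \<inter> (\<lambda>t. \<bar>P s * Q t - P t * Q s\<bar>) -` {..<\<epsilon>})"
      by (intro continuous_openin_preimage_gen) auto
    then show "\<exists>U. openin ?I U \<and> s \<in> U \<and> (\<forall>t\<in>U. \<gamma> t \<in> mball (\<gamma> s) \<epsilon>)"
      using s \<open>\<epsilon> > 0\<close> in_M det_abs[of s] by (intro exI conjI) auto
  qed
  \<comment> \<open>\<open>e\<close> wraps the interval once around the unit circle and identifies
    only its ends, as \<open>\<gamma>\<close> does. Being a quotient map by compactness, it lets
    \<open>\<gamma>\<close> descend to a map \<open>g\<close> on the circle.\<close>
  define e where "e = (\<lambda>s. cis (2 * pi * s / L))"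
  have e_img: "e ` {0..L} = sphere 0 1"
  proof (intro equalityI subsetI)
    fix z :: complex assume z: "z \<in> sphere 0 1"
    have "z = cis (Arg2pi z)"
      using z complex_norm_eq_1_exp cis_conv_exp by (metis mem_sphere_0)
    then have "z = e (L * Arg2pi z / (2 * pi))" using L by (simp add: e_def)
    moreover have "L * Arg2pi z / (2 * pi) \<in> {0..L}"
      using L Arg2pi_ge_0[of z] Arg2pi_lt_2pi[of z] by (auto simp: field_simps)
    ultimately show "z \<in> e ` {0..L}" by blast
  qed (auto simp: e_def)
  have e_eq: "s = t \<or> {s, t} = {0, L}" if "s \<in> {0..L}" "t \<in> {0..L}" "e s = e t" for s t
  proof -
    have "sin (2 * pi * s / L) = sin (2 * pi * t / L) \<and> cos (2 * pi * s / L) = cos (2 * pi * t / L)"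
      using that by (simp add: e_def complex_eq_iff)
    then obtain n :: int where "2 * pi * s / L = 2 * pi * t / L + 2 * pi * n"
      unfolding sin_cos_eq_iff by blast
    then have "2 * pi * (s / L) = 2 * pi * (t / L + n)" by (simp add: algebra_simps)
    then have "s / L = t / L + n" by (simp only: mult_cancel_left) simp
    then have n: "s = t + n * L" using L by (simp add: field_simps)
    have "n * L \<le> L" "- L \<le> n * L" using n that by auto
    then have "n \<le> 1" "-1 \<le> n"
      using L mult_right_le_imp_le[of n L 1] mult_right_le_imp_le[of "-1" L n] by auto
    then consider "n = 0" | "n = 1" | "n = -1" by linarith
    then show ?thesis using n that by cases auto
  qed
  have "continuous_map ?I ?S e"
    using e_img L by (auto simp: e_def intro!: continuous_intros)
  moreover have "compact_space ?I" by (simp add: compact_space_subtopology)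
  moreover have "Hausdorff_space ?S" by (simp add: Hausdorff_space_subtopology)
  ultimately have "quotient_map ?I ?S e"
    using e_img by (intro continuous_closed_imp_quotient_map continuous_imp_closed_map) auto
  moreover have "continuous_map ?I (subtopology mtopology ?C) \<gamma>"
    using \<gamma>_cont by (auto simp: continuous_map_in_subtopology)
  moreover have "\<gamma> s = \<gamma> t" if "s \<in> topspace ?I" "t \<in> topspace ?I" "e s = e t" for s t
    using e_eq[of s t] that closed by (auto simp: doubleton_eq_iff)
  ultimately obtain g where g: "continuous_map ?S (subtopology mtopology ?C) g"
    "g ` topspace ?S = \<gamma> ` topspace ?I" "\<And>s. s \<in> topspace ?I \<Longrightarrow> g (e s) = \<gamma> s"
    by (rule quotient_map_lift_exists) blast+
  have C_M: "?C \<subseteq> M" using in_M by auto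
  have "inj_on g (sphere 0 1)"
  proof -
    have "e ` {0..<L} = sphere 0 1"
    proof -
      have "e L = e 0" using L by (simp add: e_def)
      then have "e L \<in> e ` {0..<L}" "{0..L} = insert L {0..<L}" using L by auto
      then show ?thesis using e_img by (metis image_insert insert_absorb)
    qed
    moreover have "inj_on g (e ` {0..<L})"
    proof (rule inj_on_imageI)
      show "inj_on (g \<circ> e) {0..<L}"
        using inj g(3) by (auto simp: inj_on_def)
    qed
    ultimately show ?thesis by simp
  qed
  moreover have "compact_space ?S" by (simp add: compact_space_subtopology)
  moreover have "Hausdorff_space (subtopology mtopology ?C)"
    by (simp add: Hausdorff_space_subtopology Hausdorff_space_mtopology)
  ultimately have "homeomorphic_map ?S (subtopology mtopology ?C) g"
    using g C_M by (intro continuous_imp_homeomorphic_map) (auto simp: Int_absorb1)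
  then have homeo: "subtopology mtopology ?C homeomorphic_space ?S"
    using homeomorphic_map_imp_homeomorphic_space homeomorphic_space_sym by blast

  have conn: "connectedin mtopology (\<gamma> ` {s..t})" if "0 \<le> s" "t \<le> L" for s t
  proof -
    have "connectedin ?I {s..t}" using that by (auto simp: connectedin_subtopology)
    then show ?thesis using \<gamma>_cont connectedin_continuous_map_image by blast
  qed
  have circ: "d (\<gamma> t1) (\<gamma> t3) * d (\<gamma> t2) (\<gamma> t4) =
      d (\<gamma> t1) (\<gamma> t2) * d (\<gamma> t3) (\<gamma> t4) + d (\<gamma> t1) (\<gamma> t4) * d (\<gamma> t2) (\<gamma> t3)"
    if "0 \<le> t1" "t1 < t2" "t2 < t3" "t3 < t4" "t4 \<le> L" for t1 t2 t3 t4
    using that by (simp add: det algebra_simps)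
  have same: "connected_component_of (subtopology mtopology (?C - {\<gamma> t1, \<gamma> t3})) (\<gamma> t2) (\<gamma> t4)"
    if "t1 \<in> {0..<L}" "t3 \<in> {0..<L}" "0 \<le> t2" "t2 < t4" "t4 < L" "t2 < t1 \<and> t1 < t4 \<longleftrightarrow> t2 < t3 \<and> t3 < t4"
      "t1 \<noteq> t2" "t1 \<noteq> t4" "t3 \<noteq> t2" "t3 \<noteq> t4"
    for t1 t2 t3 t4
  proof -
    \<comment> \<open>\<open>T\<close> is an arc from \<open>\<gamma> t2\<close> to
      \<open>\<gamma> t4\<close> that avoids \<open>\<gamma> t1\<close> and
      \<open>\<gamma> t3\<close>: the inner one if neither parameter lies between \<open>t2\<close>
      and \<open>t4\<close>, otherwise the outer one through
      \<open>\<gamma> L = \<gamma> 0\<close>.\<close>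
    define T where "T = (if t2 < t1 \<and> t1 < t4 then \<gamma> ` {t4..L} \<union> \<gamma> ` {0..t2} else \<gamma> ` {t2..t4})"
    have "connectedin mtopology T"
    proof (cases "t2 < t1 \<and> t1 < t4")
      case True
      have "\<gamma> L \<in> \<gamma> ` {t4..L}" "\<gamma> 0 \<in> \<gamma> ` {0..t2}"
        using that by auto
      then have "\<gamma> ` {t4..L} \<inter> \<gamma> ` {0..t2} \<noteq> {}"
        using closed by auto
      then show ?thesis using True that conn unfolding T_def
        by (auto intro!: connectedin_Un)
    next
      case False
      then show ?thesis using that conn unfolding T_def by auto
    qed
    moreover have "T \<subseteq> ?C - {\<gamma> t1, \<gamma> t3}"
    proof -
      have ne: "\<gamma> s \<noteq> \<gamma> u" if "s \<in> {0..L}" "u \<in> {0..<L}" "s \<noteq> u" "\<not> (s = L \<and> u = 0)" for s u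
      proof (cases "s = L")
        case True
        then show ?thesis using inj_onD[OF inj, of 0 u] closed that L by auto
      next
        case False
        then show ?thesis using inj_onD[OF inj, of s u] that by auto
      qed
      define S where "S = (if t2 < t1 \<and> t1 < t4 then {t4..L} \<union> {0..t2} else {t2..t4})"
      have "T = \<gamma> ` S" by (simp add: T_def S_def image_Un)
      moreover have "S \<subseteq> {0..L}" "t1 \<notin> S" "t3 \<notin> S" "L \<in> S \<Longrightarrow> t1 \<noteq> 0 \<and> t3 \<noteq> 0"
        using that by (auto simp: S_def split: if_splits)
      ultimately show ?thesis
        using ne[of _ t1] ne[of _ t3] that(1,2) by (auto simp: subset_iff)
    qed
    moreover have "\<gamma> t2 \<in> T" "\<gamma> t4 \<in> T"
      using that by (auto simp: T_def)
    ultimately show ?thesis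
      unfolding connected_component_of_def connectedin_subtopology by blast
  qed
  have "d x z * d y w = d x y * d z w + d x w * d y z"
    if in_C: "x \<in> ?C" "y \<in> ?C" "z \<in> ?C" "w \<in> ?C" and dist: "distinct [x, y, z, w]"
      and sep: "\<not> connected_component_of (subtopology mtopology (?C - {x, z})) y w" for x y z w
  proof -
    obtain t1 t2 t3 t4 where t: "x = \<gamma> t1" "y = \<gamma> t2" "z = \<gamma> t3" "w = \<gamma> t4"
      "t1 \<in> {0..<L}" "t2 \<in> {0..<L}" "t3 \<in> {0..<L}" "t4 \<in> {0..<L}"
      using in_C unfolding C_eq by blast
    have "distinct [t1, t2, t3, t4]" using dist t by auto
    \<comment> \<open>The first two cases are not interlaced and contradict \<open>sep\<close>. The
      other eight are the rotations of the cyclic order \<open>x, y, z, w\<close> and of its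
      reverse.\<close>
    then consider "t2 < t4" "t2 < t1 \<and> t1 < t4 \<longleftrightarrow> t2 < t3 \<and> t3 < t4"
      | "t4 < t2" "t4 < t1 \<and> t1 < t2 \<longleftrightarrow> t4 < t3 \<and> t3 < t2"
      | "t1 < t2" "t2 < t3" "t3 < t4" | "t2 < t3" "t3 < t4" "t4 < t1" | "t3 < t4" "t4 < t1" "t1 < t2"
      | "t4 < t1" "t1 < t2" "t2 < t3"
      | "t1 < t4" "t4 < t3" "t3 < t2" | "t4 < t3" "t3 < t2" "t2 < t1" | "t3 < t2" "t2 < t1" "t1 < t4"
      | "t2 < t1" "t1 < t4" "t4 < t3"
      by (smt (verit) distinct_length_2_or_more)
    then show ?thesis
    proof cases
      case 1
      then have False using same[of t1 t3 t2 t4] sep t \<open>distinct [t1, t2, t3, t4]\<close> by auto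
      then show ?thesis ..
    next
      case 2
      then have False using same[of t1 t3 t4 t2] sep t \<open>distinct [t1, t2, t3, t4]\<close>
        by (auto simp: connected_component_of_sym)
      then show ?thesis ..
    qed (use t circ[of t1 t2 t3 t4] circ[of t2 t3 t4 t1] circ[of t3 t4 t1 t2] circ[of t4 t1 t2 t3]
          circ[of t1 t4 t3 t2] circ[of t4 t3 t2 t1] circ[of t3 t2 t1 t4] circ[of t2 t1 t4 t3]
        in \<open>simp_all add: commute algebra_simps\<close>)
  qed
  then show ?thesis
    unfolding is_circle_def using homeo C_M by blast
qed

section \<open>The tower of extensions\<close>

text \<open>\<open>Node n x y s\<close> is the point at parameter \<open>s\<close> on the segment from \<open>x\<close> to \<open>y\<close> that is attached
  at stage \<open>n\<close>. Every stage attaches fresh segments, since a point attached later need not have affine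
  distances to an older segment.\<close>

datatype 'a seg_tree = Leaf 'a | Node nat "'a seg_tree" "'a seg_tree" real

definition leaf_value :: "'a seg_tree \<Rightarrow> 'a" where
  "leaf_value p = (case p of Leaf x \<Rightarrow> x | Node n x y s \<Rightarrow> undefined)"

text \<open>Relative to stage \<open>n\<close>, a node of any other stage counts as an old point and
  is its own end.\<close>

definition left_end :: "nat \<Rightarrow> 'a seg_tree \<Rightarrow> 'a seg_tree" where
  "left_end n p = (case p of Leaf x \<Rightarrow> p | Node m x y s \<Rightarrow> if m = n then x else p)"

definition right_end :: "nat \<Rightarrow> 'a seg_tree \<Rightarrow> 'a seg_tree" where
  "right_end n p = (case p of Leaf x \<Rightarrow> p | Node m x y s \<Rightarrow> if m = n then y else p)"

text \<open>The default 0 keeps the parameter of every tree in the unit interval, since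
  \<open>t_range\<close> is not restricted to \<open>N\<close>.\<close>

definition seg_param :: "nat \<Rightarrow> 'a seg_tree \<Rightarrow> real" where
  "seg_param n p =
     (case p of Leaf x \<Rightarrow> 0 | Node m x y s \<Rightarrow> if m = n \<and> 0 < s \<and> s < 1 then s else 0)"

primrec level :: "'a set \<Rightarrow> nat \<Rightarrow> 'a seg_tree set" where
  "level X 0 = Leaf ` X"
| "level X (Suc n) = level X n \<union>
     {Node n x y s | x y s. x \<in> level X n \<and> y \<in> level X n \<and> x \<noteq> y \<and> 0 < s \<and> s < 1}"

primrec level_dist :: "('a \<Rightarrow> 'a \<Rightarrow> real) \<Rightarrow> nat \<Rightarrow> 'a seg_tree \<Rightarrow> 'a seg_tree \<Rightarrow> real" where
  "level_dist d 0 = (\<lambda>p q. d (leaf_value p) (leaf_value q))"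
| "level_dist d (Suc n) = seg_dist (level_dist d n) (left_end n) (right_end n) (seg_param n)"

text \<open>Distances stay fixed once both points are present, so every stage containing them gives
  the same value.\<close>

definition tower_dist :: "'a set \<Rightarrow> ('a \<Rightarrow> 'a \<Rightarrow> real) \<Rightarrow> 'a seg_tree \<Rightarrow> 'a seg_tree \<Rightarrow> real" where
  "tower_dist X d p q = level_dist d (LEAST n. {p, q} \<subseteq> level X n) p q"

definition seg_point :: "nat \<Rightarrow> 'a seg_tree \<Rightarrow> 'a seg_tree \<Rightarrow> real \<Rightarrow> 'a seg_tree" where
  "seg_point n x y s = (if s \<le> 0 then x else if 1 \<le> s then y else Node n x y s)"

lemma level_mono: "m \<le> n \<Longrightarrow> level X m \<subseteq> level X n"
  by (rule lift_Suc_mono_le[of "level X"]) auto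

lemma level_Node_less: "Node m x y s \<in> level X n \<Longrightarrow> m < n"
  by (induction n) auto

lemma Node_notin_level [simp]: "Node n x y s \<notin> level X n"
  using level_Node_less by blast

lemma level_old:
  assumes "p \<in> level X n"
  shows "left_end n p = p" "right_end n p = p" "seg_param n p = 0"
  using assms by (auto simp: left_end_def right_end_def seg_param_def split: seg_tree.split)

lemma level_new [simp]:
  "left_end n (Node n x y s) = x" "right_end n (Node n x y s) = y"
  "seg_param n (Node n x y s) = (if 0 < s \<and> s < 1 then s else 0)"
  by (auto simp: left_end_def right_end_def seg_param_def)

lemma level_segment_extension:
  assumes "Ptolemy_metric (level X n) (level_dist d n)"
  shows "segment_extension (level X n) (level X (Suc n)) (level_dist d n)
           (left_end n) (right_end n) (seg_param n)"
proof
  show "0 \<le> seg_param n p" "seg_param n p \<le> 1" for p :: "'a seg_tree"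
    by (auto simp: seg_param_def split: seg_tree.split)
qed (use assms in \<open>auto simp: level_old\<close>)

lemma Ptolemy_metric_level:
  assumes "Ptolemy_metric X d"
  shows "Ptolemy_metric (level X n) (level_dist d n)"
proof (induction n)
  case 0
  interpret Metric_space X d using assms by (simp add: Ptolemy_metric_def)
  have "Metric_space (level X 0) (level_dist d 0)"
    by unfold_locales (auto simp: leaf_value_def commute triangle)
  then show ?case
    using assms by (auto simp: Ptolemy_metric_def leaf_value_def)
next
  case (Suc n)
  then show ?case
    using segment_extension.Ptolemy_metric_D[OF level_segment_extension] by simp
qed

lemma level_dist_mono:
  assumes "Ptolemy_metric X d" "m \<le> n" "p \<in> level X m" "q \<in> level X m"
  shows "level_dist d n p q = level_dist d m p q"
  using assms(2)
proof (induction n rule: dec_induct)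
  case (step n)
  then have "p \<in> level X n" "q \<in> level X n" using assms level_mono by blast+
  then show ?case
    using segment_extension.D_old[OF level_segment_extension[OF Ptolemy_metric_level[OF assms(1)]]] step
    by simp
qed simp

lemma tower_dist_eq:
  assumes "Ptolemy_metric X d" "p \<in> level X n" "q \<in> level X n"
  shows "tower_dist X d p q = level_dist d n p q"
proof -
  have n: "{p, q} \<subseteq> level X n" using assms by simp
  show ?thesis
    unfolding tower_dist_def
    using LeastI[of "\<lambda>n. {p, q} \<subseteq> level X n", OF n] Least_le[of "\<lambda>n. {p, q} \<subseteq> level X n", OF n]
    by (intro level_dist_mono[OF assms(1), symmetric]) auto
qed

text \<open>The metric axioms and the Ptolemy inequality involve at most four points, so each can be
  checked at a single stage.\<close>

lemma finite_subset_level: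
  assumes "finite F" "F \<subseteq> (\<Union>n. level X n)"
  obtains n where "F \<subseteq> level X n"
proof -
  have "\<exists>n. F \<subseteq> level X n"
    using assms
  proof (induction F)
    case (insert p F)
    then obtain m n where "p \<in> level X m" "F \<subseteq> level X n" by auto
    then have "insert p F \<subseteq> level X (max m n)"
      using level_mono[of m "max m n" X] level_mono[of n "max m n" X] by auto
    then show ?case ..
  qed simp
  then show ?thesis using that by blast
qed

lemma Ptolemy_metric_tower:
  assumes "Ptolemy_metric X d"
  shows "Ptolemy_metric (\<Union>n. level X n) (tower_dist X d)"
proof -
  have met: "Metric_space (level X n) (level_dist d n)" for n
    using Ptolemy_metric_level[OF assms] by (simp add: Ptolemy_metric_def)
  have "Metric_space (\<Union>n. level X n) (tower_dist X d)"
  proof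
    \<comment> \<open>\<open>Metric_space\<close> demands nonnegativity and symmetry for all
      arguments, also for trees that lie in no stage; both hold at whatever stage
      \<open>LEAST\<close> yields.\<close>
    show "0 \<le> tower_dist X d x y" for x y
      unfolding tower_dist_def using Metric_space.nonneg[OF met] .
    show "tower_dist X d x y = tower_dist X d y x" for x y
      unfolding tower_dist_def insert_commute[of x y] using Metric_space.commute[OF met] .
    show "tower_dist X d x y = 0 \<longleftrightarrow> x = y" if pts: "x \<in> (\<Union>n. level X n)" "y \<in> (\<Union>n. level X n)" for x y
    proof -
      obtain n where "{x, y} \<subseteq> level X n" by (rule finite_subset_level[of "{x, y}" X]) (use pts in auto)
      then show ?thesis using Metric_space.zero[OF met] by (simp add: tower_dist_eq[OF assms, of _ n])
    qed
    show "tower_dist X d x z \<le> tower_dist X d x y + tower_dist X d y z"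
      if pts: "x \<in> (\<Union>n. level X n)" "y \<in> (\<Union>n. level X n)" "z \<in> (\<Union>n. level X n)" for x y z
    proof -
      obtain n where "{x, y, z} \<subseteq> level X n"
        by (rule finite_subset_level[of "{x, y, z}" X]) (use pts in auto)
      then show ?thesis using Metric_space.triangle[OF met] by (simp add: tower_dist_eq[OF assms, of _ n])
    qed
  qed
  moreover have "tower_dist X d x y * tower_dist X d z w
      \<le> tower_dist X d x z * tower_dist X d y w + tower_dist X d x w * tower_dist X d y z"
    if pts: "{x, y, z, w} \<subseteq> (\<Union>n. level X n)" for x y z w
  proof -
    obtain n where "{x, y, z, w} \<subseteq> level X n"
      by (rule finite_subset_level[of "{x, y, z, w}" X]) (use pts in auto)
    then show ?thesis
      using Ptolemy_metric_level[OF assms, of n] by (simp add: tower_dist_eq[OF assms, of _ n] Ptolemy_metric_def)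
  qed
  ultimately show ?thesis by (simp add: Ptolemy_metric_def)
qed

lemma seg_point_in_level:
  "\<lbrakk>x \<in> level X n; y \<in> level X n; x \<noteq> y\<rbrakk> \<Longrightarrow> seg_point n x y s \<in> level X (Suc n)"
  by (auto simp: seg_point_def)

section \<open>Distances between points of attached segments\<close>

context
  fixes X :: "'a set" and d :: "'a \<Rightarrow> 'a \<Rightarrow> real" and n :: nat
  assumes Ptolemy_X: "Ptolemy_metric X d"
begin

interpretation segment_extension "level X n" "level X (Suc n)" "level_dist d n"
    "left_end n" "right_end n" "seg_param n"
  by (intro level_segment_extension Ptolemy_metric_level Ptolemy_X)

lemma seg_bilin_seg_point:
  assumes "x \<in> level X n" "y \<in> level X n" "0 \<le> s" "s \<le> 1"
  shows "E (seg_point n x y s) q = (1 - s) * E x q + s * E y q"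
proof -
  consider "s = 0" | "s = 1" | "0 < s" "s < 1" using assms by linarith
  then show ?thesis
    by cases (use assms in \<open>simp_all add: seg_point_def seg_bilin_def level_old\<close>)
qed

lemma seg_bilin_seg_points:
  assumes "x \<in> level X n" "y \<in> level X n" "0 \<le> s" "s \<le> 1"
    and "u \<in> level X n" "v \<in> level X n" "0 \<le> r" "r \<le> 1"
  shows "E (seg_point n x y s) (seg_point n u v r) =
    (1 - s) * ((1 - r) * level_dist d n x u + r * level_dist d n x v) +
    s * ((1 - r) * level_dist d n y u + r * level_dist d n y v)"
proof -
  let ?q = "seg_point n u v r"
  have "E z ?q = (1 - r) * level_dist d n z u + r * level_dist d n z v" if "z \<in> level X n" for z
    using assms that seg_bilin_seg_point[of u v r z] by (simp add: E_sym[of z ?q] E_old commute[of z])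
  then show ?thesis
    using assms by (simp add: seg_bilin_seg_point)
qed

text \<open>If \<open>s = 0\<close> or \<open>r = 1\<close>, one point is old and the bilinear form
  applies; its coefficient \<open>(1 - s) r + s (1 - r)\<close> is then
  \<open>r - s\<close>.\<close>

lemma level_dist_seg_point_same:
  assumes "x \<in> level X n" "y \<in> level X n" "x \<noteq> y" "0 \<le> s" "s \<le> r" "r \<le> 1"
  shows "level_dist d (Suc n) (seg_point n x y s) (seg_point n x y r) = (r - s) * level_dist d n x y"
proof (cases "0 < s \<and> r < 1")
  case True
  then show ?thesis using assms by (simp add: D_sim seg_point_def)
next
  case False
  let ?p = "seg_point n x y s" and ?q = "seg_point n x y r"
  have sr: "0 \<le> s" "s \<le> 1" "0 \<le> r" "r \<le> 1" using assms by auto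
  show ?thesis
  proof (cases "?p = ?q")
    case True
    then have "r = s" using False assms by (auto simp: seg_point_def split: if_splits)
    then show ?thesis by (simp add: D_sim)
  next
    case pq: False
    have "\<not> sim ?p ?q"
      using False pq assms by (auto simp: seg_point_def level_old split: if_splits)
    moreover have "E ?p ?q = ((1 - s) * r + s * (1 - r)) * level_dist d n x y"
      using sr assms by (simp add: seg_bilin_seg_points commute[of y x] algebra_simps)
    moreover have "s = 0 \<or> r = 1" using False assms by auto
    ultimately show ?thesis by (auto simp: D_not_sim)
  qed
qed

lemma level_dist_seg_point:
  assumes "x \<in> level X n" "y \<in> level X n" "u \<in> level X n" "v \<in> level X n"
    and "(x, y) \<noteq> (u, v)" "x \<noteq> y" "u \<noteq> v" "0 \<le> s" "s \<le> 1" "0 \<le> r" "r \<le> 1"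
  shows "level_dist d (Suc n) (seg_point n x y s) (seg_point n u v r) =
    (1 - s) * ((1 - r) * level_dist d n x u + r * level_dist d n x v) +
    s * ((1 - r) * level_dist d n y u + r * level_dist d n y v)"
proof -
  let ?p = "seg_point n x y s" and ?q = "seg_point n u v r"
  have "D ?p ?q = E ?p ?q"
  \<comment> \<open>Points of different segments are \<open>sim\<close> only if they are one common
    old end, where \<open>D\<close> and \<open>E\<close> agree.\<close>
  proof (cases "sim ?p ?q")
    case True
    then have "?p = ?q" "?p \<in> level X n"
      using assms by (auto simp: seg_point_def level_old split: if_splits)
    then show ?thesis by (simp add: D_old E_old)
  qed (rule D_not_sim)
  then show ?thesis
    using assms by (simp add: seg_bilin_seg_points)
qed

end

text \<open>The curve runs through the three sides attached at one stage containing the corners,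
  with one unit of parameter per side.\<close>

lemma tower_triangle_curve:
  assumes "Ptolemy_metric X d" and xyz: "{x, y, z} \<subseteq> (\<Union>n. level X n)" and "distinct [x, y, z]"
  obtains \<gamma> P Q where "\<And>s. \<gamma> s \<in> (\<Union>n. level X n)" "\<gamma> (3::real) = \<gamma> 0" "inj_on \<gamma> {0..<3}"
    "continuous_on {0..3} P" "continuous_on {0..3} Q"
    "\<And>s t. \<lbrakk>0 \<le> s; s \<le> t; t \<le> 3\<rbrakk> \<Longrightarrow> tower_dist X d (\<gamma> s) (\<gamma> t) = P s * Q t - P t * Q s"
    "{x, y, z} \<subseteq> \<gamma> ` {0..3}"
proof -
  obtain n where n: "{x, y, z} \<subseteq> level X n"
    by (rule finite_subset_level[of "{x, y, z}" X]) (use xyz in auto)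
  then have mem: "x \<in> level X n" "y \<in> level X n" "z \<in> level X n" by auto
  have ne: "x \<noteq> y" "y \<noteq> x" "y \<noteq> z" "z \<noteq> y" "z \<noteq> x" "x \<noteq> z" using assms by auto
  interpret L: Metric_space "level X n" "level_dist d n"
    using Ptolemy_metric_level[OF assms(1)] by (simp add: Ptolemy_metric_def)
  define \<gamma> where "\<gamma> = (\<lambda>t. if t \<le> 1 then seg_point n x y t
    else if t \<le> 2 then seg_point n y z (t - 1) else seg_point n z x (t - 2))"
  define e f g where "e = level_dist d n x y" "f = level_dist d n x z" "g = level_dist d n y z"
  have e: "e \<noteq> 0" using mem ne by (simp add: e_f_g_def)
  have dist: "level_dist d n x y = e" "level_dist d n y x = e" "level_dist d n x z = f"
    "level_dist d n z x = f" "level_dist d n y z = g" "level_dist d n z y = g"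
    "level_dist d n x x = 0" "level_dist d n y y = 0" "level_dist d n z z = 0"
    using mem by (auto simp: e_f_g_def L.commute)
  txt \<open>The vectors \<open>v = (1, 0)\<close>, \<open>(0, e)\<close>, \<open>(- g / e, f)\<close> have the distances of \<open>x\<close>, \<open>y\<close>, \<open>z\<close> as
    determinants; \<open>(P, Q)\<close> runs through them along the polygonal path that ends in \<open>- v\<close>, turning
    counterclockwise by a half turn, so that all determinants along it are nonnegative.\<close>
  define P where "P = (\<lambda>t::real. max 0 (1 - t) - g / e * max 0 (min (t - 1) (3 - t)) - max 0 (t - 2))"
  define Q where "Q = (\<lambda>t::real. e * max 0 (min t (2 - t)) + f * max 0 (min (t - 1) (3 - t)))"
  have P: "P t = 1 - t" "Q t = e * t" if "0 \<le> t" "t \<le> 1" for t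
    using that by (auto simp: P_def Q_def max_def min_def)
  have P': "P t = - (g / e * (t - 1))" "Q t = e * (2 - t) + f * (t - 1)" if "1 < t" "t \<le> 2" for t
    using that by (auto simp: P_def Q_def max_def min_def)
  have P'': "P t = - (g / e * (3 - t)) - (t - 2)" "Q t = f * (3 - t)" if "2 < t" "t \<le> 3" for t
    using that by (auto simp: P_def Q_def max_def min_def)
  have in_level: "\<gamma> t \<in> level X (Suc n)" for t
    unfolding \<gamma>_def using mem ne by (auto intro!: seg_point_in_level simp del: level.simps)
  have det: "level_dist d (Suc n) (\<gamma> s) (\<gamma> t) = P s * Q t - P t * Q s"
    if st: "0 \<le> s" "s \<le> t" "t \<le> 3" for s t
  proof -
    note same = level_dist_seg_point_same[OF assms(1)] and diff = level_dist_seg_point[OF assms(1)]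
    \<comment> \<open>\<open>(P, Q)\<close> is affine on each side. For two different sides the
      determinant is therefore bilinear, like the distance; on one side it is \<open>t - s\<close>
      times the determinant of the corners.\<close>
    consider "s \<le> 1" "t \<le> 1" | "s \<le> 1" "1 < t" "t \<le> 2" | "s \<le> 1" "2 < t"
      | "1 < s" "s \<le> 2" "1 < t" "t \<le> 2" | "1 < s" "s \<le> 2" "2 < t" | "2 < s" "2 < t"
      using st by linarith
    then show ?thesis
      by cases (use st mem ne in \<open>(simp add: \<gamma>_def P P' P'' same diff dist del: level_dist.simps,
        simp add: field_simps e)+\<close>)
  qed
  show ?thesis
  proof
    show "\<gamma> s \<in> (\<Union>n. level X n)" for s using in_level by blast
    show "\<gamma> 3 = \<gamma> 0" by (simp add: \<gamma>_def seg_point_def)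
    show "inj_on \<gamma> {0..<3}"
      using mem ne by (auto simp: inj_on_def \<gamma>_def seg_point_def split: if_splits)
    show "continuous_on {0..3} P" "continuous_on {0..3} Q"
      unfolding P_def Q_def by (intro continuous_intros)+
    show "tower_dist X d (\<gamma> s) (\<gamma> t) = P s * Q t - P t * Q s" if "0 \<le> s" "s \<le> t" "t \<le> 3" for s t
      using det[OF that] tower_dist_eq[OF assms(1) in_level in_level] by simp
    have "\<gamma> 0 = x" "\<gamma> 1 = y" "\<gamma> 2 = z" by (auto simp: \<gamma>_def seg_point_def)
    moreover have "{\<gamma> 0, \<gamma> 1, \<gamma> 2} \<subseteq> \<gamma> ` {0..3}" by auto
    ultimately show "{x, y, z} \<subseteq> \<gamma> ` {0..3}" by simp
  qed
qed

section \<open>Coding the trees in the prescribed type\<close>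

primrec encode :: "('a + real \<Rightarrow> 'a + real \<Rightarrow> 'a + real) \<Rightarrow> 'a seg_tree \<Rightarrow> 'a + real" where
  "encode pr (Leaf x) = pr (Inr (-1)) (Inl x)"
| "encode pr (Node n x y s) =
     pr (Inr (real n)) (pr (Inr s) (pr (encode pr x) (encode pr y)))"

text \<open>The first component separates the constructors: it is -1 for a leaf and the nonnegative
  \<open>real n\<close> for a node.\<close>

lemma inj_encode:
  assumes pr: "\<And>u v u' v'. pr u v = pr u' v' \<longleftrightarrow> u = u' \<and> v = v'"
  shows "inj (encode pr)"
proof (rule injI)
  fix p q show "encode pr p = encode pr q \<Longrightarrow> p = q"
  proof (induction p arbitrary: q)
    case (Leaf x)
    then show ?case by (cases q) (auto simp: pr)
  next
    case (Node n x y s)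
    then show ?case by (cases q) (auto simp: pr)
  qed
qed

text \<open>The summand \<open>real\<close> makes the sum type infinite, hence equipotent to its
  square, which supplies the pairing \<open>pr\<close>. Singletons carry the codes into the set
  type.\<close>

lemma ex_inj_seg_tree: "\<exists>h :: 'a seg_tree \<Rightarrow> ('a + real) set. inj h"
proof -
  have "infinite (UNIV :: ('a + real) set)"
    by (simp add: finite_Plus_UNIV_iff infinite_UNIV_char_0)
  then obtain pr :: "('a + real) \<times> ('a + real) \<Rightarrow> 'a + real"
    where "bij_betw pr (UNIV \<times> UNIV) UNIV"
    using card_of_Times_same_infinite card_of_ordIso by blast
  then have "inj pr" by (simp add: bij_betw_def)
  then have "inj (encode (\<lambda>u v. pr (u, v)))"
    by (intro inj_encode) (auto dest: injD)
  then have "inj (\<lambda>p. {encode (\<lambda>u v. pr (u, v)) p})"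
    by (auto simp: inj_def)
  then show ?thesis by blast
qed

theorem theorem2p8:
  fixes X :: "'a set" and d :: "'a \<Rightarrow> 'a \<Rightarrow> real"
  assumes "Ptolemy_metric X d"
  shows "\<exists>(Y :: ('a + real) set set) (dY :: ('a + real) set \<Rightarrow> ('a + real) set \<Rightarrow> real)
           (f :: 'a \<Rightarrow> ('a + real) set).
           Ptolemy_metric Y dY \<and> f ` X \<subseteq> Y \<and>
           (\<forall>x\<in>X. \<forall>y\<in>X. dY (f x) (f y) = d x y) \<and>
           (\<forall>x\<in>Y. \<forall>y\<in>Y. \<forall>z\<in>Y. distinct [x, y, z] \<longrightarrow>
              (\<exists>\<sigma>. is_circle Y dY \<sigma> \<and> {x, y, z} \<subseteq> \<sigma>))"
proof -
  obtain h :: "'a seg_tree \<Rightarrow> ('a + real) set" where h: "inj h"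
    using ex_inj_seg_tree by blast
  define T where "T = (\<Union>n. level X n)"
  define Y where "Y = h ` T"
  \<comment> \<open>Through \<open>inv h\<close> the function is defined everywhere, so symmetry and
    nonnegativity also hold outside \<open>Y\<close>.\<close>
  define dY where "dY = (\<lambda>u v. tower_dist X d (inv h u) (inv h v))"
  have dY: "dY (h p) (h q) = tower_dist X d p q" for p q
    using h by (simp add: dY_def)
  have PT: "Ptolemy_metric T (tower_dist X d)"
    unfolding T_def by (rule Ptolemy_metric_tower[OF assms])
  then interpret T: Metric_space T "tower_dist X d" by (simp add: Ptolemy_metric_def)
  have met: "Metric_space Y dY"
  proof
    show "0 \<le> dY u v" "dY u v = dY v u" for u v
      by (simp_all add: dY_def T.commute)
    show "dY u v = 0 \<longleftrightarrow> u = v" if "u \<in> Y" "v \<in> Y" for u v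
      using that h by (auto simp: Y_def dY dest: injD)
    show "dY u w \<le> dY u v + dY v w" if "u \<in> Y" "v \<in> Y" "w \<in> Y" for u v w
      using that T.triangle by (auto simp: Y_def dY)
  qed
  then have "Ptolemy_metric Y dY"
    using PT by (auto simp: Ptolemy_metric_def Y_def dY)
  moreover have "(\<lambda>x. h (Leaf x)) ` X \<subseteq> Y"
  proof -
    have "Leaf x \<in> T" if "x \<in> X" for x
      using that unfolding T_def by (intro UN_I[of 0]) auto
    then show ?thesis by (auto simp: Y_def)
  qed
  moreover have "dY (h (Leaf x)) (h (Leaf y)) = d x y" if "x \<in> X" "y \<in> X" for x y
    using that tower_dist_eq[OF assms, of "Leaf x" 0 "Leaf y"] by (simp add: dY leaf_value_def)
  moreover have "\<exists>\<sigma>. is_circle Y dY \<sigma> \<and> {u, v, w} \<subseteq> \<sigma>"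
    if "u \<in> Y" "v \<in> Y" "w \<in> Y" "distinct [u, v, w]" for u v w
  proof -
    obtain x y z where xyz: "u = h x" "v = h y" "w = h z" "{x, y, z} \<subseteq> T"
      using \<open>u \<in> Y\<close> \<open>v \<in> Y\<close> \<open>w \<in> Y\<close> by (auto simp: Y_def)
    have "distinct [x, y, z]" using xyz \<open>distinct [u, v, w]\<close> by auto
    with xyz(4) obtain \<gamma> and P Q :: "real \<Rightarrow> real" where \<gamma>: "\<And>s. \<gamma> s \<in> T" "\<gamma> (3::real) = \<gamma> 0" "inj_on \<gamma> {0..<3}"
      "continuous_on {0..3} P" "continuous_on {0..3} Q"
      "\<And>s t. \<lbrakk>0 \<le> s; s \<le> t; t \<le> 3\<rbrakk> \<Longrightarrow> tower_dist X d (\<gamma> s) (\<gamma> t) = P s * Q t - P t * Q s"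
      "{x, y, z} \<subseteq> \<gamma> ` {0..3}"
      by (rule tower_triangle_curve[OF assms, folded T_def]) (rule that)
    have "is_circle Y dY ((h \<circ> \<gamma>) ` {0..3})"
    proof (rule Ptolemy_circle_from_determinant[OF met])
      show "inj_on (h \<circ> \<gamma>) {0..<3}"
        using \<gamma>(3) h by (meson comp_inj_on inj_on_subset subset_UNIV)
    qed (use \<gamma> in \<open>auto simp: Y_def dY\<close>)
    moreover have "{u, v, w} \<subseteq> (h \<circ> \<gamma>) ` {0..3}"
      unfolding xyz image_comp[symmetric] using \<gamma>(7) by auto
    ultimately show ?thesis by blast
  qed
  ultimately show ?thesis
    by (intro exI[of _ Y] exI[of _ dY] exI[of _ "\<lambda>x. h (Leaf x)"]) blast
qed

end
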